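(* Let $a,b$ be integers with $1 \le a \le b$. If $(a,b) \ne (1,1)$, then $(a,b)$ is not regular; that is, there exists $r \in \mathbb{N}$ and an $r$-coloring of $\mathbb{N}$ admitting no monochromatic $(a,b)$-triple.
   Context: For integers $1 \le a \le b$, an $(a,b)$-triple is a triple $(x, ax+d, bx+2d)$ with $x,d$ positive integers. A coloring admits a monochromatic $(a,b)$-triple if all three entries of some $(a,b)$-triple receive the same color. The pair $(a,b)$ is $r$-regular if every $r$-coloring of $\mathbb{N}$ admits a monochromatic $(a,b)$-triple, and regular if it is $r$-regular for every $r\in\mathbb{N}$. *)

theory Defs
  imports Main "HOL-Library.FuncSet"
begin

definition ab_triple :: "nat \<Rightarrow> nat \<Rightarrow> nat \<times> nat \<times> nat \<Rightarrow> bool" where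
  "ab_triple a b t \<longleftrightarrow> (\<exists>x d. x \<ge> 1 \<and> d \<ge> 1 \<and> t = (x, a * x + d, b * x + 2 * d))"

(* The coloured set is the positive integers; the value of c at 0 is unconstrained and is
   never used below, since all entries of an (a,b)-triple are positive. *)
definition r_coloring :: "nat \<Rightarrow> (nat \<Rightarrow> nat) \<Rightarrow> bool" where
  "r_coloring r c \<longleftrightarrow> c \<in> {1..} \<rightarrow> {1..r}"

definition admits_mono_triple :: "(nat \<Rightarrow> nat) \<Rightarrow> nat \<Rightarrow> nat \<Rightarrow> bool" where
  "admits_mono_triple c a b \<longleftrightarrow> (\<exists>x y z. ab_triple a b (x, y, z) \<and> c x = c y \<and> c y = c z)"

definition r_regular :: "nat \<Rightarrow> nat \<Rightarrow> nat \<Rightarrow> bool" where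
  "r_regular r a b \<longleftrightarrow> (\<forall>c. r_coloring r c \<longrightarrow> admits_mono_triple c a b)"

definition regular :: "nat \<Rightarrow> nat \<Rightarrow> bool" where
  "regular a b \<longleftrightarrow> (\<forall>r\<ge>1. r_regular r a b)"

end

(* Colour n by floor (log_beta n) mod M with M large: two numbers of equal colour and bounded
   ratio then have ratio below beta. In a triple (x, y, z) the ratio z / y lies between b / a and 2,
   so for a < b it is bounded and bounded away from 1, and a small beta excludes equal colours.
   If a = b >= 2, equal colours of y and z force d < a x, so y / x lies between a and 2 a,
   again bounded and bounded away from 1. *)
theory Submission
  imports Defs Complex_Main
begin

text \<open>If \<open>\<beta> ^ m > K\<close>, a ratio of at most \<open>K\<close> raises the floor
  of \<open>log \<beta>\<close> by at most \<open>m\<close>. Equal colours make this rise a multiple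
  of the modulus \<open>m + 1\<close>, hence zero, and two logarithms with the same floor differ by
  less than 1.\<close>

lemma log_coloring:
  fixes \<beta> K :: real
  assumes "\<beta> > 1"
  obtains r c where "r \<ge> 1" "r_coloring r c"
    "\<And>u v. \<lbrakk>1 \<le> u; u \<le> v; real v \<le> K * real u; c u = c v\<rbrakk> \<Longrightarrow> real v < \<beta> * real u"
proof -
  obtain m where m: "K < \<beta> ^ m"
    using real_arch_pow[OF assms] by blast
  define F where "F n = \<lfloor>log \<beta> (real n)\<rfloor>" for n :: nat
  define M where "M = int m + 1"
  \<comment> \<open>The added 1 moves the residues from \<open>{0..<M}\<close> to the palette
    \<open>{1..M}\<close>.\<close>
  define c where "c n = nat (F n mod M) + 1" for n
  have M: "M > 0" by (simp add: M_def)
  have "c n \<in> {1..nat M}" for n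
    using M by (simp add: c_def Suc_le_eq)
  then have "r_coloring (nat M) c"
    by (auto simp: r_coloring_def)
  moreover have "real v < \<beta> * real u"
    if uv: "1 \<le> u" "u \<le> v" "real v \<le> K * real u" and eq: "c u = c v" for u v
  proof -
    have "F u \<le> F v"
      unfolding F_def using uv assms by (intro floor_mono) simp
    have "K * real u \<le> \<beta> ^ m * real u"
      using m by (intro mult_right_mono) auto
    then have "real v \<le> \<beta> ^ m * real u"
      using uv(3) by linarith
    then have "log \<beta> (real v) \<le> log \<beta> (\<beta> ^ m * real u)"
      using uv assms by (subst log_le_cancel_iff) auto
    also have "\<dots> = real m + log \<beta> (real u)"
      using uv assms by (subst log_mult) (auto simp: log_nat_power)
    finally have "F v < F u + M"
      unfolding F_def M_def by linarith
    moreover have "F u mod M = F v mod M"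
      using eq pos_mod_sign[OF M] by (simp add: c_def eq_nat_nat_iff)
    then have "M dvd F v - F u"
      by (metis mod_eq_dvd_iff)
    ultimately have "F v = F u"
      using \<open>F u \<le> F v\<close> zdvd_imp_le[of M "F v - F u"] by linarith
    then have "log \<beta> (real v) < 1 + log \<beta> (real u)"
      unfolding F_def by linarith
    also have "\<dots> = log \<beta> (\<beta> * real u)"
      using uv assms by (subst log_mult) auto
    finally show ?thesis
      using uv assms by (subst (asm) log_less_cancel_iff) auto
  qed
  ultimately show thesis
    using that[of "nat M" c] M by auto
qed

lemma not_regularI:
  assumes "r \<ge> 1" "r_coloring r c"
    and "\<And>x d. \<lbrakk>x \<ge> 1; d \<ge> 1; c x = c (a * x + d); c (a * x + d) = c (b * x + 2 * d)\<rbrakk> \<Longrightarrow> False"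
  shows "\<not> regular a b"
  using assms unfolding regular_def r_regular_def admits_mono_triple_def ab_triple_def by blast

theorem theorem1:
  fixes a b :: nat
  assumes "1 \<le> a" and "a \<le> b" and "(a, b) \<noteq> (1, 1)"
  shows "\<not> regular a b"
proof (cases "a < b")
  case True
  \<comment> \<open>As \<open>b \<ge> a + 1\<close> and \<open>2 \<ge> 1 + 1 / a\<close>, the ratio
    z / y is at least \<open>1 + 1 / a\<close>; \<open>b + 2\<close> is a crude upper bound for
    it.\<close>
  obtain r c where rc: "r \<ge> 1" "r_coloring r c"
    and c: "\<And>u v. \<lbrakk>1 \<le> u; u \<le> v; real v \<le> real (b + 2) * real u; c u = c v\<rbrakk>
              \<Longrightarrow> real v < (1 + 1 / real a) * real u"
    using log_coloring[of "1 + 1 / real a" "real (b + 2)"] assms(1) by auto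
  show ?thesis
  proof (rule not_regularI[OF rc])
    fix x d :: nat
    assume xd: "x \<ge> 1" "d \<ge> 1" and eq: "c (a * x + d) = c (b * x + 2 * d)"
    have "b * x \<le> a * (b * x)"
      using assms(1) by simp
    then have "b * x + 2 * d \<le> (b + 2) * (a * x + d)"
      unfolding distrib_left distrib_right mult.left_commute[of b a x] by linarith
    then have "real (b * x + 2 * d) \<le> real (b + 2) * real (a * x + d)"
      unfolding of_nat_mult[symmetric] of_nat_le_iff .
    moreover have "a * x \<le> b * x"
      using assms(2) by simp
    ultimately have "real (b * x + 2 * d) < (1 + 1 / real a) * real (a * x + d)"
      using c[OF _ _ _ eq] xd by linarith
    also have "\<dots> = real (a + 1) * real x + (1 + 1 / real a) * real d"
      using assms(1) by (simp add: field_simps)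
    \<comment> \<open>Termwise: \<open>a + 1 \<le> b\<close> and
      \<open>1 / a \<le> 1\<close>.\<close>
    also have "\<dots> \<le> real b * real x + 2 * real d"
      using True assms(1) by (intro add_mono mult_right_mono) (auto simp: field_simps)
    finally show False by simp
  qed
next
  case False
  then have b: "b = a" and a: "2 \<le> a"
    using assms by auto
  \<comment> \<open>The threshold \<open>3 / 2\<close> is the value of z / y at
    \<open>d = a * x\<close>, and it lies below \<open>2 \<le> a\<close>, hence below y / x. The
    bound \<open>2 * a\<close> serves both pairs: z / y never exceeds 2, and y / x stays below
    \<open>2 * a\<close> once \<open>d < a * x\<close>.\<close>
  obtain r c where rc: "r \<ge> 1" "r_coloring r c"
    and c: "\<And>u v. \<lbrakk>1 \<le> u; u \<le> v; real v \<le> real (2 * a) * real u; c u = c v\<rbrakk>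
              \<Longrightarrow> real v < 3 / 2 * real u"
    using log_coloring[of "3 / 2" "real (2 * a)"] by auto
  show ?thesis
  proof (rule not_regularI[OF rc])
    fix x d :: nat
    assume xd: "x \<ge> 1" "d \<ge> 1" and xy: "c x = c (a * x + d)"
      and yz: "c (a * x + d) = c (b * x + 2 * d)"
    have ax: "2 * x \<le> a * x"
      using a by simp
    have "a * x + 2 * d \<le> 2 * (a * x + d)" by simp
    also have "\<dots> \<le> (2 * a) * (a * x + d)"
      using a by (intro mult_right_mono) auto
    finally have "real (b * x + 2 * d) \<le> real (2 * a) * real (a * x + d)"
      unfolding b of_nat_mult[symmetric] of_nat_le_iff .
    then have "real (b * x + 2 * d) < 3 / 2 * real (a * x + d)"
      using xd b by (intro c[OF _ _ _ yz]) auto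
    then have "real d < real (a * x)"
      unfolding b by simp
    then have "d < a * x"
      unfolding of_nat_less_iff .
    then have "a * x + d \<le> (2 * a) * x" by simp
    then have "real (a * x + d) \<le> real (2 * a) * real x"
      unfolding of_nat_mult[symmetric] of_nat_le_iff .
    \<comment> \<open>This contradicts \<open>a * x + d > 2 * x\<close>.\<close>
    then have "real (a * x + d) < 3 / 2 * real x"
      using c[OF _ _ _ xy] xd ax by linarith
    then show False
      using ax xd by linarith
  qed
qed

end
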